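(* Let $S, T, U$ be pairwise disjoint finite index sets, $N = S\cup T\cup U$, and let \[ P = \{ (x,y,z) \in \mathbb{R}^S \times \mathbb{R}^T \times \mathbb{R}^U \mid Ax + By = c, ~ \ell \leq y \leq u,~ Dx + Ez \leq f \} \] be a rational polyhedron, where $A \in \mathbb{Z}^{M \times S}$, $c \in \mathbb{Z}^{M}$ and $\ell_j,u_j \in \mathbb{Z} \cup \{ \pm \infty \}$ for all $j \in T$. If $B$ is unimodular, then $y$ is totally implied integer by $x$ for $P$.
   Context: A matrix $B \in \mathbb{Z}^{M \times T}$ of rank $r$ is unimodular if for every submatrix consisting of $r$ linearly independent columns of $B$, the greatest common divisor of its subdeterminants of order $r$ equals $1$. For $S' \subseteq N$, $\mathcal{M}^{S'} \coloneqq \{ w \in \mathbb{R}^N \mid w_i \in \mathbb{Z} \ \forall i \in S' \}$. For $S',T'\subseteq N$, $x_{T'}$ is implied integer by $x_{S'}$ for $P$ if $\mathrm{conv}(P \cap \mathcal{M}^{S'}) = \mathrm{conv}(P \cap \mathcal{M}^{S' \cup T'})$; it is totally implied integer by $x_{S'}$ if it is implied integer by $x_{S''}$ for every $S''$ with $S' \subseteq S'' \subseteq N$. "$y$ totally implied integer by $x$" means $x_T$ is totally implied integer by $x_S$. *)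

theory Defs
  imports "HOL-Analysis.Analysis" "Jordan_Normal_Form.Determinant"
begin

no_notation vec_index (infixl "$" 100)

text \<open>The index set \<open>N\<close> of the variables is the finite type \<open>'n\<close>. A matrix with index set
  \<open>M \<times> T\<close> with \<open>T \<subseteq> N\<close> is a matrix with columns indexed by all of \<open>'n\<close> of which only the
  columns in \<open>T\<close> are ever read.\<close>

definition real_column :: "int^'n^'m \<Rightarrow> 'n \<Rightarrow> real^'m" where
  "real_column B j = (\<chi> i. real_of_int (B $ i $ j))"

definition block_rank :: "'n set \<Rightarrow> int^'n^'m \<Rightarrow> nat" where
  "block_rank T B = dim (real_column B ` T)"

definition columns_independent :: "int^'n^'m \<Rightarrow> 'n set \<Rightarrow> bool" where
  "columns_independent B J \<longleftrightarrow> inj_on (real_column B) J \<and> independent (real_column B ` J)"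

text \<open>The \<open>card J\<close>-rowed minors of the columns \<open>J\<close>. Since \<open>'m\<close> and \<open>'n\<close> carry no order, all
  enumerations of the chosen rows and of \<open>J\<close> are admitted, so every minor occurs together with
  its negative (for order at least 2); this does not affect the greatest common divisor.\<close>

definition subdeterminants :: "int^'n^'m \<Rightarrow> 'n set \<Rightarrow> int set" where
  "subdeterminants B J =
     {Determinant.det (Matrix.mat (card J) (card J) (\<lambda>(a, b). B $ \<rho> a $ \<kappa> b)) | \<rho> \<kappa>.
        inj_on \<rho> {..<card J} \<and> bij_betw \<kappa> {..<card J} J}"

definition unimodular :: "'n set \<Rightarrow> int^'n^'m \<Rightarrow> bool" where
  "unimodular T B \<longleftrightarrow>
     (\<forall>J\<subseteq>T. card J = block_rank T B \<and> columns_independent B J \<longrightarrow> Gcd (subdeterminants B J) = 1)"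

definition mixed_integer :: "'n set \<Rightarrow> (real^'n) set" where
  "mixed_integer S' = {w. \<forall>i\<in>S'. w $ i \<in> \<int>}"

definition implied_integer :: "(real^'n) set \<Rightarrow> 'n set \<Rightarrow> 'n set \<Rightarrow> bool" where
  "implied_integer P S' T' \<longleftrightarrow>
     convex hull (P \<inter> mixed_integer S') = convex hull (P \<inter> mixed_integer (S' \<union> T'))"

definition totally_implied_integer :: "(real^'n) set \<Rightarrow> 'n set \<Rightarrow> 'n set \<Rightarrow> bool" where
  "totally_implied_integer P S' T' \<longleftrightarrow> (\<forall>S''. S' \<subseteq> S'' \<longrightarrow> implied_integer P S'' T')"

definition rational_polyhedron :: "(real^'n) set \<Rightarrow> bool" where
  "rational_polyhedron P \<longleftrightarrow>
     (\<exists>F. finite F \<and> P = \<Inter>F \<and>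
        (\<forall>h\<in>F. \<exists>a b. (\<forall>i. a $ i \<in> \<rat>) \<and> b \<in> \<rat> \<and> h = {w. a \<bullet> w \<le> b}))"

end

theory Submission
  imports Defs
begin

text \<open>Fix \<open>w \<in> P\<close> with integral \<open>x\<close>-part. Since \<open>\<ell>\<close> and \<open>u\<close> are integral, keeping \<open>x\<close> and \<open>z\<close>
  fixed and letting each \<open>y\<^sub>j\<close> range over the interval from its floor to its ceiling, subject to
  \<open>B y = c - A x\<close>, gives a polytope contained in \<open>P\<close>. By Minkowski's theorem \<open>w\<close> is a convex
  combination of its extreme points. At an extreme point the columns of \<open>B\<close> belonging to
  fractional coordinates are linearly independent, so they extend to a column basis \<open>J\<close> of \<open>B\<close>.
  The \<open>J\<close>-part solves a linear system with integral right-hand side; by Cramer's rule every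
  maximal minor of \<open>B\<^sub>J\<close> times a coordinate is an integer, and as these minors have greatest
  common divisor 1 the coordinates themselves are integers.\<close>

section \<open>Integrality from coprime minors\<close>

lemma Ints_if_Gcd_multiples:
  fixes v :: real
  assumes "Gcd X = (1::int)" and "\<And>d. d \<in> X \<Longrightarrow> of_int d * v \<in> \<int>"
  shows "v \<in> \<int>"
proof -
  \<comment> \<open>The integers \<open>k\<close> with \<open>k * v\<close> integral form an ideal.
    Its least positive element \<open>g\<close> divides all of \<open>X\<close>, hence also the gcd
    1, and \<open>g = 1\<close> makes \<open>v\<close> itself integral.\<close>
  define I where "I n \<longleftrightarrow> n > 0 \<and> of_int (int n) * v \<in> \<int>" for n :: nat
  have "\<not> X \<subseteq> {0}"
    using assms(1) by (metis Gcd_0_iff zero_neq_one)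
  then obtain d where d: "d \<in> X" "d \<noteq> 0" by blast
  have "I (nat \<bar>d\<bar>)"
    using d assms(2)[OF d(1)] by (cases "d > 0") (auto simp: I_def minus_in_Ints_iff)
  define g where "g = (LEAST n. I n)"
  have g: "I g"
    unfolding g_def by (rule LeastI) fact
  \<comment> \<open>Otherwise the remainder of \<open>e\<close> modulo \<open>g\<close> would be a
    smaller positive element of the ideal.\<close>
  have "int g dvd e" if "e \<in> X" for e
  proof (rule ccontr)
    assume "\<not> int g dvd e"
    moreover have "e mod int g \<ge> 0"
      using g unfolding I_def by simp
    ultimately have pos: "e mod int g > 0"
      by (metis dvd_eq_mod_eq_0 order_le_less)
    have "of_int (e mod int g) * v = of_int e * v - of_int (e div int g) * (of_int (int g) * v)"
      by (simp add: minus_div_mult_eq_mod[symmetric] algebra_simps)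
    also have "\<dots> \<in> \<int>"
      using g Ints_diff[OF assms(2)[OF that] Ints_mult[OF Ints_of_int]] unfolding I_def by blast
    finally have "I (nat (e mod int g))"
      using pos by (simp add: I_def)
    then have "g \<le> nat (e mod int g)"
      unfolding g_def by (rule Least_le)
    moreover have "e mod int g < int g"
      using g unfolding I_def by simp
    ultimately show False using pos by simp
  qed
  then have "int g dvd Gcd X" by (rule Gcd_greatest)
  then have "g = 1" using assms(1) by simp
  then show ?thesis using g unfolding I_def by simp
qed

text \<open>Cramer's rule in adjugate form: the adjugate of \<open>M\<close> is again an integer
  matrix, and multiplying the system by it turns the left-hand side into \<open>det M\<close> times
  \<open>x\<close>.\<close>

lemma det_mult_solution_in_Ints:
  fixes M :: "int Matrix.mat" and x :: "nat \<Rightarrow> real"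
  assumes M: "M \<in> carrier_mat n n"
    and int: "\<And>a. a < n \<Longrightarrow> (\<Sum>b<n. of_int (M $$ (a, b)) * x b) \<in> \<int>"
    and k: "k < n"
  shows "of_int (Determinant.det M) * x k \<in> \<int>"
proof -
  let ?C = "adj_mat M"
  note adj = adj_mat[OF M]
  have entry: "(\<Sum>a<n. ?C $$ (k, a) * M $$ (a, b)) = (if k = b then Determinant.det M else 0)"
    if "b < n" for b
  proof -
    have "(?C * M) $$ (k, b) = (\<Sum>a<n. ?C $$ (k, a) * M $$ (a, b))"
      using that k M adj(1) by (simp add: scalar_prod_def atLeast0LessThan)
    moreover have "(?C * M) $$ (k, b) = (if k = b then Determinant.det M else 0)"
      using that k by (simp add: adj(3))
    ultimately show ?thesis by simp
  qed
  have "(\<Sum>a<n. of_int (?C $$ (k, a)) * (\<Sum>b<n. of_int (M $$ (a, b)) * x b))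
      = (\<Sum>b<n. of_int (\<Sum>a<n. ?C $$ (k, a) * M $$ (a, b)) * x b)"
    by (simp add: sum_distrib_left sum_distrib_right mult.assoc) (rule sum.swap)
  also have "\<dots> = (\<Sum>b<n. if k = b then of_int (Determinant.det M) * x b else 0)"
    by (intro sum.cong refl) (simp only: entry lessThan_iff, simp)
  also have "\<dots> = of_int (Determinant.det M) * x k"
    using k by simp
  finally have "of_int (Determinant.det M) * x k
      = (\<Sum>a<n. of_int (?C $$ (k, a)) * (\<Sum>b<n. of_int (M $$ (a, b)) * x b))" ..
  also have "\<dots> \<in> \<int>"
    by (intro Ints_sum Ints_mult Ints_of_int int) simp
  finally show ?thesis .
qed

text \<open>Each choice of \<open>card J\<close> rows cuts out a square system with integral
  right-hand side, so Cramer's rule makes the corresponding minor times \<open>v j\<close> integral;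
  coprimality of the minors removes the factor.\<close>

lemma Ints_if_Gcd_subdeterminants:
  fixes B :: "int^'n::finite^'m::finite" and v :: "'n \<Rightarrow> real"
  assumes gcd: "Gcd (subdeterminants B J) = 1"
    and int: "\<And>i. (\<Sum>j\<in>J. of_int (B $ i $ j) * v j) \<in> \<int>"
    and j: "j \<in> J"
  shows "v j \<in> \<int>"
proof (rule Ints_if_Gcd_multiples[OF gcd])
  fix d assume "d \<in> subdeterminants B J"
  then obtain \<rho> \<kappa> where
    d: "d = Determinant.det (Matrix.mat (card J) (card J) (\<lambda>(a, b). B $ \<rho> a $ \<kappa> b))"
    and \<kappa>: "bij_betw \<kappa> {..<card J} J"
    unfolding subdeterminants_def by blast
  obtain k where k: "k < card J" "j = \<kappa> k"
    using j \<kappa> by (auto simp: bij_betw_def)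
  have "(\<Sum>b<card J. of_int (B $ \<rho> a $ \<kappa> b) * v (\<kappa> b)) \<in> \<int>" for a
    using int[of "\<rho> a"] sum.reindex_bij_betw[OF \<kappa>, of "\<lambda>j. of_int (B $ \<rho> a $ j) * v j"]
    by simp
  then show "of_int d * v j \<in> \<int>"
    unfolding d k(2) by (intro det_mult_solution_in_Ints[OF _ _ k(1)]) simp_all
qed

section \<open>Independent columns, bases and kernel vectors\<close>

lemma columns_independent_extend:
  fixes B :: "int^'n::finite^'m::finite"
  assumes "F \<subseteq> T" and "columns_independent B F"
  obtains J where "F \<subseteq> J" "J \<subseteq> T" "columns_independent B J" "card J = block_rank T B"
proof -
  let ?r = "real_column B"
  obtain C where C: "?r ` F \<subseteq> C" "C \<subseteq> ?r ` T" "independent C" "?r ` T \<subseteq> span C"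
    using maximal_independent_subset_extend[of "?r ` F" "?r ` T"] assms
    by (auto simp: columns_independent_def)
  \<comment> \<open>The basis \<open>C\<close> consists of vectors, but \<open>J\<close> has to
    consist of indices. One index is chosen per added vector, so a repeated column of
    \<open>B\<close> is taken only once.\<close>
  define G where "G = inv_into T ?r ` (C - ?r ` F)"
  have rG: "?r ` G = C - ?r ` F"
    using C(2) unfolding G_def by (subst image_inv_into_cancel[of ?r T "?r ` T"]) auto
  have "inj_on ?r G"
    unfolding G_def using C(2) by (auto simp: inj_on_def f_inv_into_f subset_iff)
  then have inj: "inj_on ?r (F \<union> G)"
    using assms rG by (auto simp: inj_on_Un columns_independent_def)
  have im: "?r ` (F \<union> G) = C"
    using rG C(1) by auto
  have "G \<subseteq> T"
    unfolding G_def using C(2) by (auto intro: inv_into_into)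
  moreover have "card (F \<union> G) = block_rank T B"
    unfolding block_rank_def card_image[OF inj, symmetric] im
    using basis_card_eq_dim[OF C(2,4,3)] by simp
  ultimately show ?thesis
    using that[of "F \<union> G"] assms(1) inj im C(3) by (auto simp: columns_independent_def)
qed

text \<open>Supplies the direction in which a point can move without changing \<open>B y\<close>.
  Independence fails through a linear relation among distinct columns or through a repeated
  column.\<close>

lemma kernel_vector_if_not_columns_independent:
  fixes B :: "int^'n::finite^'m::finite"
  assumes "\<not> columns_independent B F"
  shows "\<exists>d::real^'n. d \<noteq> 0 \<and> (\<forall>j. j \<notin> F \<longrightarrow> d $ j = 0) \<and>
    (\<forall>i. (\<Sum>j\<in>F. of_int (B $ i $ j) * d $ j) = 0)"
proof (cases "inj_on (real_column B) F")
  case True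
  then have "dependent (real_column B ` F)"
    using assms by (simp add: columns_independent_def)
  then obtain u v where u: "v \<in> F" "u (real_column B v) \<noteq> 0"
    "(\<Sum>y\<in>real_column B ` F. u y *\<^sub>R y) = 0"
    by (auto simp: dependent_finite)
  define d where "d = (\<chi> j. if j \<in> F then u (real_column B j) else 0)"
  have "(\<Sum>j\<in>F. u (real_column B j) *\<^sub>R real_column B j) = 0"
    using u(3) by (simp add: sum.reindex[OF True])
  then have "(\<Sum>j\<in>F. u (real_column B j) *\<^sub>R real_column B j) $ i = 0" for i
    by simp
  then have "(\<Sum>j\<in>F. of_int (B $ i $ j) * d $ j) = 0" for i
    by (simp add: d_def real_column_def mult.commute)
  moreover have "d $ v \<noteq> 0"
    using u(1,2) by (simp add: d_def)
  then have "d \<noteq> 0" by auto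
  moreover have "d $ j = 0" if "j \<notin> F" for j
    using that by (simp add: d_def)
  ultimately show ?thesis by blast
next
  case False
  then obtain p q where pq: "p \<in> F" "q \<in> F" "p \<noteq> q" "real_column B p = real_column B q"
    by (auto simp: inj_on_def)
  \<comment> \<open>Two equal columns cancel in the difference of their unit vectors.\<close>
  define d :: "real^'n" where "d = axis p 1 - axis q 1"
  have "(\<Sum>j\<in>F. of_int (B $ i $ j) * d $ j) = of_int (B $ i $ p) - of_int (B $ i $ q)" for i
  proof -
    have "(\<Sum>j\<in>F. of_int (B $ i $ j) * d $ j)
        = (\<Sum>j\<in>F. if p = j then of_int (B $ i $ j) else 0)
          - (\<Sum>j\<in>F. if q = j then of_int (B $ i $ j) else (0::real))"
      unfolding sum_subtractf[symmetric]
      by (intro sum.cong refl) (auto simp: d_def axis_def)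
    then show ?thesis using pq(1,2) by simp
  qed
  moreover have "B $ i $ p = B $ i $ q" for i
    using arg_cong[OF pq(4), of "\<lambda>x. x $ i"] by (simp add: real_column_def)
  moreover have "d $ p \<noteq> 0"
    using pq(3) by (simp add: d_def axis_def)
  then have "d \<noteq> 0" by auto
  moreover have "d $ j = 0" if "j \<notin> F" for j
    using pq(1,2) that by (auto simp: d_def axis_def)
  ultimately show ?thesis
    by (intro exI[of _ d]) simp
qed

section \<open>The rounding polytope and its extreme points\<close>

definition rounding_polytope :: "int^'n::finite^'m::finite \<Rightarrow> 'n set \<Rightarrow> real^'n \<Rightarrow> (real^'n) set"
  where "rounding_polytope B T w = {v.
    (\<forall>j. j \<notin> T \<longrightarrow> v $ j = w $ j) \<and>
    (\<forall>j\<in>T. of_int \<lfloor>w $ j\<rfloor> \<le> v $ j \<and> v $ j \<le> of_int \<lceil>w $ j\<rceil>) \<and>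
    (\<forall>i. (\<Sum>j\<in>T. of_int (B $ i $ j) * v $ j) = (\<Sum>j\<in>T. of_int (B $ i $ j) * w $ j))}"

lemma rounding_polytope_self: "w \<in> rounding_polytope B T w"
  by (simp add: rounding_polytope_def)

lemma convex_rounding_polytope:
  fixes w :: "real^'n::finite"
  shows "convex (rounding_polytope B T w)"
proof -
  \<comment> \<open>Coordinates and row sums are written as inner products, which exhibits the set
    as an intersection of hyperplanes and half-spaces.\<close>
  have coord: "inner (axis j 1) v = v $ j" for j and v :: "real^'n"
    by (simp add: inner_axis')
  have row: "inner (\<chi> j. if j \<in> T then of_int (B $ i $ j) else 0) v
      = (\<Sum>j\<in>T. of_int (B $ i $ j) * v $ j)" for i v
    by (simp add: inner_vec_def if_distrib[of "\<lambda>x. x * _"] sum.If_cases cong: if_cong)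
  have eq: "rounding_polytope B T w =
      (\<Inter>j\<in>-T. {v. inner (axis j 1) v = w $ j}) \<inter>
      (\<Inter>j\<in>T. {v. inner (axis j 1) v \<ge> of_int \<lfloor>w $ j\<rfloor>} \<inter> {v. inner (axis j 1) v \<le> of_int \<lceil>w $ j\<rceil>}) \<inter>
      (\<Inter>i. {v. inner (\<chi> j. if j \<in> T then of_int (B $ i $ j) else 0) v
        = (\<Sum>j\<in>T. of_int (B $ i $ j) * w $ j)})"
    unfolding coord row rounding_polytope_def by auto
  show ?thesis
    unfolding eq
    by (intro convex_Int convex_INT convex_hyperplane convex_halfspace_ge convex_halfspace_le)
qed

text \<open>Bounding by floor and ceiling, rather than by the bounds of the polyhedron, confines the
  set to a box even where those bounds are infinite. Minkowski's theorem relies on this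
  compactness.\<close>

lemma compact_rounding_polytope: "compact (rounding_polytope B T w)"
proof -
  have "closed (rounding_polytope B T w)"
    unfolding rounding_polytope_def Ball_def
    by (intro closed_Collect_conj closed_Collect_all closed_Collect_imp closed_Collect_eq
        closed_Collect_le open_Collect_const continuous_intros)
  moreover have "rounding_polytope B T w \<subseteq>
      cbox (\<chi> j. of_int \<lfloor>w $ j\<rfloor>) (\<chi> j. of_int \<lceil>w $ j\<rceil>)"
  proof
    fix v assume v: "v \<in> rounding_polytope B T w"
    have "of_int \<lfloor>w $ j\<rfloor> \<le> v $ j \<and> v $ j \<le> of_int \<lceil>w $ j\<rceil>" for j
      using v by (cases "j \<in> T") (auto simp: rounding_polytope_def)
    then show "v \<in> cbox (\<chi> j. of_int \<lfloor>w $ j\<rfloor>) (\<chi> j. of_int \<lceil>w $ j\<rceil>)"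
      by (simp add: mem_box_cart)
  qed
  ultimately show ?thesis
    using bounded_subset[OF bounded_cbox] compact_eq_bounded_closed by blast
qed

text \<open>Otherwise a nonzero kernel vector \<open>d\<close> is supported on the fractional
  coordinates. These have slack in both directions, so \<open>v\<close> is the midpoint of two
  points \<open>v + e *\<^sub>R d\<close> and \<open>v - e *\<^sub>R d\<close> of the
  polytope.\<close>

lemma columns_independent_fractional:
  fixes v w :: "real^'n::finite"
  assumes "v extreme_point_of rounding_polytope B T w"
  shows "columns_independent B {j \<in> T. v $ j \<notin> \<int>}"
proof (rule ccontr)
  define F where "F = {j \<in> T. v $ j \<notin> \<int>}"
  assume "\<not> columns_independent B {j \<in> T. v $ j \<notin> \<int>}"
  then obtain d :: "real^'n" where d: "d \<noteq> 0" "\<And>j. j \<notin> F \<Longrightarrow> d $ j = 0"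
    "\<And>i. (\<Sum>j\<in>F. of_int (B $ i $ j) * d $ j) = 0"
    using kernel_vector_if_not_columns_independent[of B F] unfolding F_def[symmetric] by blast
  have v: "v \<in> rounding_polytope B T w"
    using assms by (simp add: extreme_point_of_def)
  have dT: "(\<Sum>j\<in>T. of_int (B $ i $ j) * d $ j) = 0" for i
  proof -
    have "(\<Sum>j\<in>T. of_int (B $ i $ j) * d $ j) = (\<Sum>j\<in>F. of_int (B $ i $ j) * d $ j)"
      by (intro sum.mono_neutral_right) (auto simp: F_def d(2)[unfolded F_def])
    then show ?thesis by (simp add: d(3))
  qed
  \<comment> \<open>A non-integral coordinate cannot equal its integral bounds.\<close>
  have strict: "of_int \<lfloor>w $ j\<rfloor> < v $ j \<and> v $ j < of_int \<lceil>w $ j\<rceil>" if "j \<in> F" for j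
  proof -
    have "v $ j \<noteq> of_int k" for k
      using that by (auto simp: F_def)
    moreover have "of_int \<lfloor>w $ j\<rfloor> \<le> v $ j \<and> v $ j \<le> of_int \<lceil>w $ j\<rceil>"
      using that v by (simp add: F_def rounding_polytope_def)
    ultimately show ?thesis by (simp add: order.strict_iff_order) metis
  qed
  \<comment> \<open>These are finitely many strict inequalities, continuous in \<open>e\<close> and
    valid at \<open>e = 0\<close>, so they persist for small positive \<open>e\<close>. The factor
    \<open>s\<close> will be the sign 1 or -1.\<close>
  have ev: "\<forall>\<^sub>F e in at_right 0. \<forall>j\<in>F. of_int \<lfloor>w $ j\<rfloor> < v $ j + s * e * d $ j
      \<and> v $ j + s * e * d $ j < of_int \<lceil>w $ j\<rceil>" for s :: real
  proof (intro eventually_ball_finite ballI eventually_conj)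
    fix j assume j: "j \<in> F"
    have lim: "((\<lambda>e. v $ j + s * e * d $ j) \<longlongrightarrow> v $ j) (at_right 0)"
      by (auto intro!: tendsto_eq_intros)
    show "\<forall>\<^sub>F e in at_right 0. of_int \<lfloor>w $ j\<rfloor> < v $ j + s * e * d $ j"
      using strict[OF j] by (intro order_tendstoD[OF lim]) simp
    show "\<forall>\<^sub>F e in at_right 0. v $ j + s * e * d $ j < of_int \<lceil>w $ j\<rceil>"
      using strict[OF j] by (intro order_tendstoD[OF lim]) simp
  qed simp
  have "\<forall>\<^sub>F e in at_right (0::real). e > 0"
    by (simp add: eventually_at_right_less)
  with ev[of 1] ev[of "-1"] have "\<forall>\<^sub>F e in at_right (0::real). e > 0 \<and>
      (\<forall>s\<in>{1, -1}. \<forall>j\<in>F. of_int \<lfloor>w $ j\<rfloor> < v $ j + s * e * d $ j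
        \<and> v $ j + s * e * d $ j < of_int \<lceil>w $ j\<rceil>)"
    by eventually_elim auto
  then have "\<exists>e>0. \<forall>s\<in>{1, -1}. \<forall>j\<in>F. of_int \<lfloor>w $ j\<rfloor> < v $ j + s * e * d $ j
      \<and> v $ j + s * e * d $ j < of_int \<lceil>w $ j\<rceil>"
    by (rule eventually_happens'[rotated]) simp
  then obtain e :: real where e: "e > 0"
    and e_bd: "\<forall>s\<in>{1, -1}. \<forall>j\<in>F. of_int \<lfloor>w $ j\<rfloor> < v $ j + s * e * d $ j
        \<and> v $ j + s * e * d $ j < of_int \<lceil>w $ j\<rceil>"
    by (elim exE conjE)
  have mem: "v + (s * e) *\<^sub>R d \<in> rounding_polytope B T w" if s: "s \<in> {1, -1}" for s
  proof -
    have "of_int \<lfloor>w $ j\<rfloor> \<le> v $ j + s * e * d $ j \<and> v $ j + s * e * d $ j \<le> of_int \<lceil>w $ j\<rceil>"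
      if "j \<in> T" for j
    proof (cases "j \<in> F")
      case True
      then have "of_int \<lfloor>w $ j\<rfloor> < v $ j + s * e * d $ j \<and> v $ j + s * e * d $ j < of_int \<lceil>w $ j\<rceil>"
        using e_bd s by blast
      then show ?thesis by simp
    next
      case False
      then show ?thesis using v that by (simp add: d(2) rounding_polytope_def)
    qed
    moreover have "v $ j + s * e * d $ j = w $ j" if "j \<notin> T" for j
      using v that d(2)[of j] by (simp add: F_def rounding_polytope_def)
    moreover have "(\<Sum>j\<in>T. of_int (B $ i $ j) * (v $ j + s * e * d $ j))
        = (\<Sum>j\<in>T. of_int (B $ i $ j) * w $ j)" for i
    proof -
      have "(\<Sum>j\<in>T. of_int (B $ i $ j) * (v $ j + s * e * d $ j))
          = (\<Sum>j\<in>T. of_int (B $ i $ j) * v $ j) + s * e * (\<Sum>j\<in>T. of_int (B $ i $ j) * d $ j)"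
        by (simp add: sum_distrib_left sum.distrib[symmetric] algebra_simps)
      then show ?thesis
        using v dT by (simp add: rounding_polytope_def)
    qed
    ultimately show ?thesis
      by (simp add: rounding_polytope_def)
  qed
  let ?a = "v + e *\<^sub>R d" and ?b = "v - e *\<^sub>R d"
  have ab: "?a \<in> rounding_polytope B T w" "?b \<in> rounding_polytope B T w"
    using mem[of 1] mem[of "-1"] by simp_all
  have "?a - ?b = (2 * e) *\<^sub>R d"
    by (simp add: scaleR_2 flip: scaleR_scaleR)
  then have "?a \<noteq> ?b"
    using e d(1) by auto
  moreover have "midpoint ?a ?b = v"
    by (simp add: midpoint_def flip: scaleR_2)
  ultimately have "v \<in> open_segment ?a ?b"
    by (metis midpoint_in_open_segment)
  then show False
    using assms ab by (auto simp: extreme_point_of_def)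
qed

lemma extreme_point_integral:
  assumes uni: "unimodular T B"
    and rhs: "\<And>i. (\<Sum>j\<in>T. of_int (B $ i $ j) * w $ j) \<in> \<int>"
    and ext: "v extreme_point_of rounding_polytope B T w"
    and j: "j \<in> T"
  shows "v $ j \<in> \<int>"
proof -
  obtain J where J: "{j \<in> T. v $ j \<notin> \<int>} \<subseteq> J" "J \<subseteq> T" "columns_independent B J"
    "card J = block_rank T B"
    using columns_independent_extend[OF _ columns_independent_fractional[OF ext]] by blast
  then have gcd: "Gcd (subdeterminants B J) = 1"
    using uni by (auto simp: unimodular_def)
  have "(\<Sum>j\<in>J. of_int (B $ i $ j) * v $ j) \<in> \<int>" for i
  proof -
    have "(\<Sum>j\<in>T. of_int (B $ i $ j) * v $ j) \<in> \<int>"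
      using ext rhs[of i] by (simp add: extreme_point_of_def rounding_polytope_def)
    \<comment> \<open>All fractional coordinates lie in \<open>J\<close>, so the remaining terms are
      integral and can be moved to the right-hand side.\<close>
    moreover have "(\<Sum>j\<in>T - J. of_int (B $ i $ j) * v $ j) \<in> \<int>"
      using J(1) by (intro Ints_sum Ints_mult) auto
    moreover have "(\<Sum>j\<in>T. of_int (B $ i $ j) * v $ j)
        = (\<Sum>j\<in>T - J. of_int (B $ i $ j) * v $ j) + (\<Sum>j\<in>J. of_int (B $ i $ j) * v $ j)"
      using J(2) by (intro sum.subset_diff) simp_all
    ultimately show ?thesis
      using Ints_diff by fastforce
  qed
  then have "v $ j \<in> \<int>" if "j \<in> J"
    using Ints_if_Gcd_subdeterminants[OF gcd, of "\<lambda>j. v $ j"] that by blast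
  then show ?thesis
    using J(1) j by blast
qed

section \<open>Integral bounds survive rounding; implied integrality\<close>

lemma integral_lower_bound_le_floor:
  assumes "a \<in> range (\<lambda>k::int. ereal (real_of_int k)) \<union> {-\<infinity>, \<infinity>}" and "a \<le> ereal x"
    and "of_int \<lfloor>x\<rfloor> \<le> y"
  shows "a \<le> ereal y"
proof -
  \<comment> \<open>An integer below \<open>x\<close> is below its floor. An infinite
    \<open>a\<close> is either trivial or excluded by \<open>a \<le> ereal x\<close>.\<close>
  have "of_int k \<le> y" if "of_int k \<le> x" for k
    using that assms(3) by (metis le_floor_iff order_trans)
  then show ?thesis using assms(1,2) by auto
qed

lemma integral_upper_bound_ge_ceiling:
  assumes "a \<in> range (\<lambda>k::int. ereal (real_of_int k)) \<union> {-\<infinity>, \<infinity>}" and "ereal x \<le> a"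
    and "y \<le> of_int \<lceil>x\<rceil>"
  shows "ereal y \<le> a"
proof -
  have "y \<le> of_int k" if "x \<le> of_int k" for k
    using that assms(3) by (metis ceiling_le_iff order_trans)
  then show ?thesis using assms(1,2) by auto
qed

theorem theorem13:
  fixes S T U :: "'n::finite set"
    and A B :: "int^'n^'m::finite" and c :: "int^'m"
    and l u :: "'n \<Rightarrow> ereal"
    and D E :: "real^'n^'k::finite" and f :: "real^'k"
    and P :: "(real^'n) set"
  assumes "S \<inter> T = {}" and "S \<inter> U = {}" and "T \<inter> U = {}" and "S \<union> T \<union> U = UNIV"
    and "\<forall>j\<in>T. l j \<in> range (\<lambda>k::int. ereal (real_of_int k)) \<union> {-\<infinity>, \<infinity>}"
    and "\<forall>j\<in>T. u j \<in> range (\<lambda>k::int. ereal (real_of_int k)) \<union> {-\<infinity>, \<infinity>}"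
    and "P = {w.
      (\<forall>i. (\<Sum>j\<in>S. real_of_int (A $ i $ j) * w $ j) + (\<Sum>j\<in>T. real_of_int (B $ i $ j) * w $ j)
             = real_of_int (c $ i)) \<and>
      (\<forall>j\<in>T. l j \<le> ereal (w $ j) \<and> ereal (w $ j) \<le> u j) \<and>
      (\<forall>k. (\<Sum>j\<in>S. D $ k $ j * w $ j) + (\<Sum>j\<in>U. E $ k $ j * w $ j) \<le> f $ k)}"
    and "rational_polyhedron P"
    and "unimodular T B"
  shows "totally_implied_integer P S T"
  unfolding totally_implied_integer_def implied_integer_def
proof (intro allI impI equalityI)
  fix S'' assume S'': "S \<subseteq> S''"
  let ?H = "convex hull (P \<inter> mixed_integer (S'' \<union> T))"
  show "?H \<subseteq> convex hull (P \<inter> mixed_integer S'')"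
    by (intro hull_mono) (auto simp: mixed_integer_def)
  show "convex hull (P \<inter> mixed_integer S'') \<subseteq> ?H"
  proof (intro hull_minimal convex_convex_hull subsetI)
    fix w assume w: "w \<in> P \<inter> mixed_integer S''"
    let ?Q = "rounding_polytope B T w"
    \<comment> \<open>Since \<open>S \<subseteq> S''\<close>, the \<open>x\<close>-part of
      \<open>w\<close> is integral, and hence so is \<open>c - A x\<close>.\<close>
    have rhs: "(\<Sum>j\<in>T. of_int (B $ i $ j) * w $ j) \<in> \<int>" for i
    proof -
      have "(\<Sum>j\<in>S. of_int (A $ i $ j) * w $ j) \<in> \<int>"
        using w S'' by (intro Ints_sum Ints_mult) (auto simp: mixed_integer_def)
      moreover have "(\<Sum>j\<in>T. of_int (B $ i $ j) * w $ j)
          = of_int (c $ i) - (\<Sum>j\<in>S. of_int (A $ i $ j) * w $ j)"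
        using w assms(7) by (simp add: eq_diff_eq add.commute)
      ultimately show ?thesis by simp
    qed
    \<comment> \<open>Only coordinates in \<open>T\<close> differ between \<open>v\<close> and
      \<open>w\<close>. Those in \<open>S'' - T\<close> keep their integrality, while all
      coordinates in \<open>T\<close>, including any in \<open>S''\<close>, are integral by
      extremality.\<close>
    have "v \<in> P \<inter> mixed_integer (S'' \<union> T)" if ext: "v extreme_point_of ?Q" for v
    proof -
      have v: "v \<in> ?Q"
        using ext by (simp add: extreme_point_of_def)
      have eq: "v $ j = w $ j" if "j \<notin> T" for j
        using v that by (simp add: rounding_polytope_def)
      \<comment> \<open>With \<open>X = S\<close> and \<open>X = U\<close> this keeps
        \<open>A x\<close> and the inequalities in \<open>x\<close> and \<open>z\<close>
        unchanged.\<close>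
      have sums: "(\<Sum>j\<in>X. g j * v $ j) = (\<Sum>j\<in>X. g j * w $ j)" if "X \<inter> T = {}" for X g
        using that by (intro sum.cong refl arg_cong2[where f = "(*)"] eq) blast
      have "v \<in> P"
      proof -
        have "l j \<le> ereal (v $ j) \<and> ereal (v $ j) \<le> u j" if "j \<in> T" for j
          using integral_lower_bound_le_floor[of "l j" "w $ j" "v $ j"]
            integral_upper_bound_ge_ceiling[of "u j" "w $ j" "v $ j"]
            assms(5,6) w v that unfolding assms(7) rounding_polytope_def by blast
        moreover have "(\<Sum>j\<in>T. of_int (B $ i $ j) * v $ j) = (\<Sum>j\<in>T. of_int (B $ i $ j) * w $ j)" for i
          using v by (simp add: rounding_polytope_def)
        moreover have "U \<inter> T = {}"
          using assms(3) by blast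
        ultimately show ?thesis
          using w unfolding assms(7) by (simp add: sums assms(1))
      qed
      moreover have "v $ j \<in> \<int>" if "j \<in> S'' \<union> T" for j
      proof (cases "j \<in> T")
        case True
        then show ?thesis by (rule extreme_point_integral[OF assms(9) rhs ext])
      next
        case False
        then show ?thesis using w that by (auto simp: eq mixed_integer_def)
      qed
      ultimately show ?thesis by (simp add: mixed_integer_def)
    qed
    then have "convex hull {v. v extreme_point_of ?Q} \<subseteq> ?H"
      by (intro hull_mono) blast
    moreover have "w \<in> convex hull {v. v extreme_point_of ?Q}"
      using Krein_Milman_Minkowski[OF compact_rounding_polytope convex_rounding_polytope]
        rounding_polytope_self by blast
    ultimately show "w \<in> ?H" by blast
  qed
qed

end
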